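(* Let $(X_k)_{k\ge1}$ be a stationary ergodic sequence of random variables with values in $\mathbb{R}$, with common distribution $\mu$, with $|X_k|\le A$ almost surely for all $k$, satisfying the Devroye inequality with constants $D(\eta)$, $\eta\in(0,1]$. Assume that for any $\eta\in(0,1]$ there is a constant $C_\eta>0$ such that the auto-covariance $C_u(\ell)$ of any $\eta$-Hölder continuous function $u:\mathbb{R}\to\mathbb{R}$ satisfies $$\sum_{\ell=1}^\infty|C_u(\ell)|\le C_\eta\,\Vert u\Vert_\eta^2 .$$ Let $\mathcal{E}_n=\frac1n\sum_{j=1}^n\delta_{X_j}$ be the empirical measure. Then, for any $\eta\in(0,1]$, there exists a positive constant $a(\eta)$ such that for all $t>0$ and $n\ge1$, $$\mathbb{P}\left(\kappa(\mathcal{E}_n,\mu)>t+\frac{a(\eta)}{n^{1/(2(1+\eta))}}\right)\le\frac{D(1)}{n\,t^2},$$ where $\kappa$ is the Kantorovich distance.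
   Context: Kantorovich distance between probability measures on $\mathbb{R}$: $\kappa(\mu_1,\mu_2)=\sup_{g\in\mathscr{L}}\int g\,d(\mu_1-\mu_2)$, where $\mathscr{L}$ is the set of real-valued Lipschitz functions on $\mathbb{R}$ with Lipschitz constant at most one. Auto-covariance: $C_u(\ell)=\mathbb{E}(u(X_1)u(X_\ell))-(\mathbb{E}(u(X_1)))^2$, $\ell\ge1$. $\Vert u\Vert_\eta$ denotes the $\eta$-Hölder constant of $u$. $A>0$ is a constant. For $\eta\in(0,1]$, a function $K:\mathbb{R}^n\to\mathbb{R}$ is separately $\eta$-Hölder if for every $1\le j\le n$ $$L_j(K)=\sup_{x_1,\ldots,x_n}\ \sup_{\tilde x_j\ne x_j}\frac{|K(x_1,\ldots,x_j,\ldots,x_n)-K(x_1,\ldots,\tilde x_j,\ldots,x_n)|}{|x_j-\tilde x_j|^\eta}<\infty .$$ The process satisfies the Devroye inequality if for every $\eta\in(0,1]$ there is a constant $D=D(\eta)>0$ such that for every integer $n\ge1$ and every real-valued separately $\eta$-Hölder function $K$ on $\mathbb{R}^n$, $\mathrm{var}(K(X_1,\ldots,X_n))\le D\sum_{j=1}^n L_j(K)^2$. *)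

theory Defs
  imports "HOL-Probability.Probability"
begin

(* A process (X_k), k >= 1, is a function X :: nat => 'a => real whose value at index 0 is
   never used.  Its path is re-indexed from 0 to live in the product space over all of nat. *)
definition path :: "(nat \<Rightarrow> 'a \<Rightarrow> real) \<Rightarrow> 'a \<Rightarrow> nat \<Rightarrow> real" where
  "path X \<omega> = (\<lambda>i. X (Suc i) \<omega>)"

definition process_law :: "'a measure \<Rightarrow> (nat \<Rightarrow> 'a \<Rightarrow> real) \<Rightarrow> (nat \<Rightarrow> real) measure" where
  "process_law M X = distr M (PiM UNIV (\<lambda>_. borel)) (path X)"

definition shift :: "(nat \<Rightarrow> real) \<Rightarrow> nat \<Rightarrow> real" where
  "shift x = (\<lambda>i. x (Suc i))"

definition stationary_process :: "'a measure \<Rightarrow> (nat \<Rightarrow> 'a \<Rightarrow> real) \<Rightarrow> bool" where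
  "stationary_process M X \<longleftrightarrow>
     distr (process_law M X) (PiM UNIV (\<lambda>_. borel)) shift = process_law M X"

definition ergodic_process :: "'a measure \<Rightarrow> (nat \<Rightarrow> 'a \<Rightarrow> real) \<Rightarrow> bool" where
  "ergodic_process M X \<longleftrightarrow>
     (\<forall>B\<in>sets (PiM UNIV (\<lambda>_. borel)). shift -` B = B \<longrightarrow> measure (process_law M X) B \<in> {0, 1})"

(* The supremum is taken in ereal, so it is meaningful also when it is infinite.  For measures
   with finite first moment every 1-Lipschitz g is integrable; otherwise the Bochner integral
   of a non-integrable g is 0 by convention. *)
definition kantorovich :: "real measure \<Rightarrow> real measure \<Rightarrow> ereal" where
  "kantorovich \<mu>1 \<mu>2 =
     (SUP g\<in>{g :: real \<Rightarrow> real. 1-lipschitz_on UNIV g}. ereal ((LINT x|\<mu>1. g x) - (LINT x|\<mu>2. g x)))"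

definition empirical_measure :: "(nat \<Rightarrow> 'a \<Rightarrow> real) \<Rightarrow> nat \<Rightarrow> 'a \<Rightarrow> real measure" where
  "empirical_measure X n \<omega> =
     measure_of UNIV (sets borel)
       (\<lambda>B. (1 / of_nat n) * (\<Sum>j=1..n. emeasure (return borel (X j \<omega>)) B))"

(* measure_of yields the null measure unless its argument is countably additive; here it is. *)
lemma emeasure_empirical_measure:
  assumes "B \<in> sets borel"
  shows "emeasure (empirical_measure X n \<omega>) B =
    (1 / of_nat n) * (\<Sum>j=1..n. emeasure (return borel (X j \<omega>)) B)"
  unfolding empirical_measure_def
proof (rule emeasure_measure_of_sigma)
  show "sigma_algebra UNIV (sets (borel :: real measure))"
    using sets.sigma_algebra_axioms[of "borel :: real measure"] by simp
  show "countably_additive (sets borel)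
    (\<lambda>B. 1 / of_nat n * (\<Sum>j=1..n. emeasure (return borel (X j \<omega>)) B))"
  proof (rule countably_additiveI)
    fix S :: "nat \<Rightarrow> real set"
    assume S: "range S \<subseteq> sets borel" "disjoint_family S"
    have "(\<Sum>i. 1 / of_nat n * (\<Sum>j=1..n. emeasure (return borel (X j \<omega>)) (S i)))
      = 1 / of_nat n * (\<Sum>j=1..n. \<Sum>i. emeasure (return borel (X j \<omega>)) (S i))"
      by (simp only: ennreal_suminf_cmult suminf_sum[OF summableI])
    also have "\<dots> = 1 / of_nat n * (\<Sum>j=1..n. emeasure (return borel (X j \<omega>)) (\<Union>i. S i))"
      using S by (intro arg_cong2[where f="(*)"] refl sum.cong suminf_emeasure) auto
    finally show "(\<Sum>i. 1 / of_nat n * (\<Sum>j=1..n. emeasure (return borel (X j \<omega>)) (S i)))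
      = 1 / of_nat n * (\<Sum>j=1..n. emeasure (return borel (X j \<omega>)) (\<Union>i. S i))" .
  qed
qed (use assms in \<open>auto simp: positive_def\<close>)

definition holder_quotients :: "real \<Rightarrow> (real \<Rightarrow> real) \<Rightarrow> real set" where
  "holder_quotients \<eta> u = {\<bar>u x - u y\<bar> / \<bar>x - y\<bar> powr \<eta> | x y. x \<noteq> y}"

definition holder_continuous :: "real \<Rightarrow> (real \<Rightarrow> real) \<Rightarrow> bool" where
  "holder_continuous \<eta> u \<longleftrightarrow> bdd_above (holder_quotients \<eta> u)"

definition holder_const :: "real \<Rightarrow> (real \<Rightarrow> real) \<Rightarrow> real" where
  "holder_const \<eta> u = Sup (holder_quotients \<eta> u)"

definition autocov :: "'a measure \<Rightarrow> (nat \<Rightarrow> 'a \<Rightarrow> real) \<Rightarrow> (real \<Rightarrow> real) \<Rightarrow> nat \<Rightarrow> real" where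
  "autocov M X u l =
     prob_space.expectation M (\<lambda>\<omega>. u (X 1 \<omega>) * u (X l \<omega>))
       - (prob_space.expectation M (\<lambda>\<omega>. u (X 1 \<omega>)))\<^sup>2"

(* R^n is the extensional function space {1..n} ->E UNIV; a function K on R^n is a function on
   nat => real of which only the values on that set matter. *)
definition coord_quotients :: "nat \<Rightarrow> real \<Rightarrow> ((nat \<Rightarrow> real) \<Rightarrow> real) \<Rightarrow> nat \<Rightarrow> real set" where
  "coord_quotients n \<eta> K j =
     {\<bar>K x - K (x(j := y))\<bar> / \<bar>x j - y\<bar> powr \<eta> | x y. x \<in> {1..n} \<rightarrow>\<^sub>E UNIV \<and> y \<noteq> x j}"

definition separately_holder :: "nat \<Rightarrow> real \<Rightarrow> ((nat \<Rightarrow> real) \<Rightarrow> real) \<Rightarrow> bool" where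
  "separately_holder n \<eta> K \<longleftrightarrow> (\<forall>j\<in>{1..n}. bdd_above (coord_quotients n \<eta> K j))"

definition coord_holder_const :: "nat \<Rightarrow> real \<Rightarrow> ((nat \<Rightarrow> real) \<Rightarrow> real) \<Rightarrow> nat \<Rightarrow> real" where
  "coord_holder_const n \<eta> K j = Sup (coord_quotients n \<eta> K j)"

(* A separately Hoelder K is continuous, hence measurable, and for a bounded process
   K(X_1, ..., X_n) is bounded, so the variance below is a genuine one. *)
definition devroye_inequality ::
  "'a measure \<Rightarrow> (nat \<Rightarrow> 'a \<Rightarrow> real) \<Rightarrow> (real \<Rightarrow> real) \<Rightarrow> bool" where
  "devroye_inequality M X D \<longleftrightarrow>
     (\<forall>\<eta>\<in>{0<..1}. D \<eta> > 0 \<and>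
        (\<forall>n\<ge>1. \<forall>K. separately_holder n \<eta> K \<longrightarrow>
           prob_space.variance M (\<lambda>\<omega>. K (\<lambda>j\<in>{1..n}. X j \<omega>))
             \<le> D \<eta> * (\<Sum>j=1..n. (coord_holder_const n \<eta> K j)\<^sup>2)))"

end

theory Submission
  imports Defs
begin

text \<open>
  Let \<open>K(x\<^sub>1, \<dots>, x\<^sub>n)\<close> be the Kantorovich distance between \<open>\<mu>\<close> and the empirical measure of
  \<open>x\<^sub>1, \<dots>, x\<^sub>n\<close>. It is separately Lipschitz with constants at most \<open>1/n\<close>, so the Devroye inequality
  with \<open>\<eta> = 1\<close> bounds its variance by \<open>D(1)/n\<close> and Chebyshev's inequality gives the deviation from
  the mean. For the mean, every 1-Lipschitz function on \<open>[-A, A]\<close> is, up to \<open>2\<delta>\<close>, a constant plus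
  a combination, with coefficients at most \<open>\<delta>\<close>, of \<open>N \<approx> 2A/\<delta>\<close> fixed ramps of width \<open>\<delta>\<close>. A ramp has
  Hoelder constant at most \<open>\<delta>\<close> to the power \<open>-\<eta>\<close>, so the covariance bound makes its empirical
  fluctuation of order \<open>\<delta>\<close> to the power \<open>-\<eta>\<close>, divided by the square root of \<open>n\<close>. Balancing this
  against \<open>\<delta>\<close> yields \<open>\<delta> = n\<close> to the power \<open>-1/(2(1+\<eta>))\<close>.
\<close>

section \<open>Ramp functions\<close>

text \<open>For \<delta> > 0 this climbs linearly from 0 to 1 on [c, c + \<delta>]. On a grid of
  mesh \<delta>, a piecewise linear interpolant is a constant plus a combination of ramps whose
  coefficients are the increments over the cells.\<close>

definition ramp :: "real \<Rightarrow> real \<Rightarrow> real \<Rightarrow> real" where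
  "ramp \<delta> c x = max 0 (min 1 ((x - c) / \<delta>))"

lemma ramp_nonneg: "0 \<le> ramp \<delta> c x" and ramp_le_1: "ramp \<delta> c x \<le> 1"
  by (auto simp: ramp_def)

lemma borel_measurable_ramp [measurable]: "ramp \<delta> c \<in> borel_measurable borel"
  unfolding ramp_def by measurable

lemma ramp_eq_0: "\<delta> > 0 \<Longrightarrow> x \<le> c \<Longrightarrow> ramp \<delta> c x = 0"
  by (auto simp: ramp_def divide_le_0_iff min_def)

lemma ramp_eq_1: "\<delta> > 0 \<Longrightarrow> x \<ge> c + \<delta> \<Longrightarrow> ramp \<delta> c x = 1"
  by (auto simp: ramp_def min_def field_simps)

text \<open>At relative distance s = |x - y| / \<delta> the ramp changes by at most min s 1, which
  is at most \<open>s powr \<eta>\<close> because 0 < \<eta> \<le> 1. Scaling back produces the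
  negative power of \<delta>.\<close>

lemma ramp_holder_quotient:
  assumes "\<delta> > 0" "\<eta> \<in> {0<..1}" "x \<noteq> y"
  shows "\<bar>ramp \<delta> c x - ramp \<delta> c y\<bar> / \<bar>x - y\<bar> powr \<eta> \<le> \<delta> powr - \<eta>"
proof -
  define s where "s = \<bar>x - y\<bar> / \<delta>"
  have s: "s > 0" using assms by (auto simp: s_def)
  \<comment> \<open>Clamping to [0, 1] does not increase distances.\<close>
  have "\<bar>ramp \<delta> c x - ramp \<delta> c y\<bar> \<le> \<bar>(x - c) / \<delta> - (y - c) / \<delta>\<bar>"
    unfolding ramp_def by linarith
  also have "\<dots> = s"
    using assms by (simp add: s_def diff_divide_distrib [symmetric] abs_divide)
  finally have 1: "\<bar>ramp \<delta> c x - ramp \<delta> c y\<bar> \<le> s" .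
  have 2: "\<bar>ramp \<delta> c x - ramp \<delta> c y\<bar> \<le> 1"
    using ramp_nonneg[of \<delta> c x] ramp_le_1[of \<delta> c x] ramp_nonneg[of \<delta> c y] ramp_le_1[of \<delta> c y]
    by linarith
  have "\<bar>ramp \<delta> c x - ramp \<delta> c y\<bar> \<le> s powr \<eta>"
  proof (cases "s \<le> 1")
    case True
    then have "s powr 1 \<le> s powr \<eta>"
      using assms s by (intro powr_mono') auto
    then show ?thesis using 1 s by simp
  next
    case False
    then have "1 \<le> s powr \<eta>" using assms by (intro ge_one_powr_ge_zero) auto
    then show ?thesis using 2 by simp
  qed
  also have "s powr \<eta> = \<bar>x - y\<bar> powr \<eta> * \<delta> powr - \<eta>"
    using assms by (simp add: s_def powr_divide powr_minus_divide)
  finally show ?thesis using assms by (simp add: divide_le_eq mult.commute)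
qed

lemma
  assumes "\<delta> > 0" "\<eta> \<in> {0<..1}"
  shows holder_continuous_ramp: "holder_continuous \<eta> (ramp \<delta> c)"
    and holder_const_ramp_le: "holder_const \<eta> (ramp \<delta> c) \<le> \<delta> powr - \<eta>"
    and holder_const_ramp_nonneg: "0 \<le> holder_const \<eta> (ramp \<delta> c)"
proof -
  have le: "q \<le> \<delta> powr - \<eta>" if "q \<in> holder_quotients \<eta> (ramp \<delta> c)" for q
    using that ramp_holder_quotient[OF assms] by (auto simp: holder_quotients_def)
  then have bdd: "bdd_above (holder_quotients \<eta> (ramp \<delta> c))"
    by (rule bdd_aboveI)
  then show "holder_continuous \<eta> (ramp \<delta> c)" by (simp add: holder_continuous_def)
  \<comment> \<open>The quotient at the points 0 and 1 makes the set nonempty and, being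
    nonnegative, bounds its supremum from below. The sign matters once the constant is
    squared.\<close>
  have mem: "\<bar>ramp \<delta> c 0 - ramp \<delta> c 1\<bar> / \<bar>0 - 1\<bar> powr \<eta> \<in> holder_quotients \<eta> (ramp \<delta> c)"
    unfolding holder_quotients_def by (intro CollectI exI[of _ 0] exI[of _ 1]) simp
  show "holder_const \<eta> (ramp \<delta> c) \<le> \<delta> powr - \<eta>"
    unfolding holder_const_def using mem le by (intro cSup_least) auto
  show "0 \<le> holder_const \<eta> (ramp \<delta> c)"
    unfolding holder_const_def by (rule order_trans[OF _ cSup_upper[OF mem bdd]]) simp
qed

text \<open>At x the ramps of the cells to the left equal 1 and their increments telescope, while
  those to the right vanish. In the cell containing x, the partial ramp and the variation of g each
  cost at most \<delta>.\<close>

lemma ramp_interpolation: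
  fixes g :: "real \<Rightarrow> real" and c :: real
  assumes lip: "1-lipschitz_on UNIV g" and \<delta>: "\<delta> > 0"
    and x: "c \<le> x" "x \<le> c + real N * \<delta>"
  shows "\<bar>g x - (g c + (\<Sum>k<N. (g (c + real (Suc k) * \<delta>) - g (c + real k * \<delta>))
            * ramp \<delta> (c + real k * \<delta>) x))\<bar> \<le> 2 * \<delta>"
proof -
  define p where "p k = c + real k * \<delta>" for k
  define G where "G n x = g c + (\<Sum>k<n. (g (p (Suc k)) - g (p k)) * ramp \<delta> (p k) x)" for n x
  have p_Suc: "p (Suc k) = p k + \<delta>" for k by (simp add: p_def algebra_simps)
  have lip': "\<bar>g a - g b\<bar> \<le> \<bar>a - b\<bar>" for a b
    using lipschitz_onD[OF lip, of a b] by (simp add: dist_real_def)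
  \<comment> \<open>Besides the error bound, the induction carries exactness beyond the node
    \<open>p n\<close>: the telescoped value \<open>g (p n)\<close> is what the estimate in the next
    cell starts from.\<close>
  have "(p n \<le> x \<longrightarrow> G n x = g (p n)) \<and> (x \<le> p n \<longrightarrow> \<bar>g x - G n x\<bar> \<le> 2 * \<delta>)" for n
  proof (induction n)
    case 0
    show ?case using x \<delta> by (auto simp: p_def G_def)
  next
    case (Suc n)
    have G_Suc: "G (Suc n) x = G n x + (g (p (Suc n)) - g (p n)) * ramp \<delta> (p n) x"
      by (simp add: G_def)
    consider "x \<le> p n" | "p n < x" "x < p (Suc n)" | "p (Suc n) \<le> x" by linarith
    then show ?case
    proof cases
      case 1
      then show ?thesis using Suc G_Suc ramp_eq_0[OF \<delta> 1] p_Suc[of n] \<delta> by auto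
    next
      case 2
      have "\<bar>(g (p (Suc n)) - g (p n)) * ramp \<delta> (p n) x\<bar> \<le> \<delta> * 1"
        unfolding abs_mult
        using lip'[of "p (Suc n)" "p n"] p_Suc[of n] \<delta> ramp_nonneg[of \<delta> "p n" x]
          ramp_le_1[of \<delta> "p n" x] by (intro mult_mono) auto
      moreover have "\<bar>g x - g (p n)\<bar> \<le> \<delta>" using lip'[of x "p n"] 2 p_Suc[of n] by linarith
      ultimately show ?thesis using Suc 2 G_Suc by auto
    next
      case 3
      then have "G (Suc n) x = g (p (Suc n))"
        using Suc G_Suc ramp_eq_1[OF \<delta>, of "p n" x] p_Suc[of n] \<delta> by auto
      then show ?thesis using lip'[of x "p (Suc n)"] 3 \<delta> by auto
    qed
  qed
  from this[of N] x show ?thesis by (simp add: p_def G_def)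
qed

section \<open>The Kantorovich distance of an empirical measure\<close>

definition empirical_mean :: "nat \<Rightarrow> (nat \<Rightarrow> real) \<Rightarrow> (real \<Rightarrow> real) \<Rightarrow> real" where
  "empirical_mean n x g = (\<Sum>j=1..n. g (x j)) / real n"

text \<open>A real-valued function of the sample points, to which the Devroye inequality can be
  applied. The supremum in the reals is meaningful by
  \<open>bdd_above_empirical_kantorovich\<close>.\<close>

definition empirical_kantorovich :: "real measure \<Rightarrow> nat \<Rightarrow> (nat \<Rightarrow> real) \<Rightarrow> real" where
  "empirical_kantorovich \<mu> n x =
     (SUP g\<in>{g. 1-lipschitz_on UNIV g}. empirical_mean n x g - (LINT y|\<mu>. g y))"

section \<open>Integration against the empirical measure\<close>

lemma empirical_measure_eq_distr:
  assumes "n \<ge> 1"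
  shows "empirical_measure X n \<omega> = distr (uniform_count_measure {1..n}) borel (\<lambda>j. X j \<omega>)"
proof (rule measure_eqI)
  show sets: "sets (empirical_measure X n \<omega>) =
      sets (distr (uniform_count_measure {1..n}) borel (\<lambda>j. X j \<omega>))"
    using sets.sigma_sets_eq[of "borel :: real measure"] by (simp add: empirical_measure_def)
  fix B assume "B \<in> sets (empirical_measure X n \<omega>)"
  then have B: "B \<in> sets borel" by (simp add: sets)
  let ?J = "{j \<in> {1..n}. X j \<omega> \<in> B}"
  have "(\<Sum>j=1..n. emeasure (return borel (X j \<omega>)) B) = (\<Sum>j=1..n. if X j \<omega> \<in> B then 1 else 0)"
    using B by (intro sum.cong) (auto simp: indicator_def)
  also have "\<dots> = of_nat (card ?J)"
    by (simp add: sum.If_cases Int_def)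
  finally have "emeasure (empirical_measure X n \<omega>) B = (1 / of_nat n) * of_nat (card ?J)"
    using emeasure_empirical_measure[OF B, of X n \<omega>] by simp
  also have "\<dots> = ennreal (real (card ?J) / real n)"
    using assms by (simp add: ennreal_of_nat_eq_real_of_nat divide_ennreal[symmetric]
        divide_ennreal_def mult.commute)
  also have "\<dots> = emeasure (distr (uniform_count_measure {1..n}) borel (\<lambda>j. X j \<omega>)) B"
    using B by (subst emeasure_distr)
      (auto simp: emeasure_uniform_count_measure space_uniform_count_measure
        intro!: arg_cong[where f=card] arg_cong2[where f="(/)"])
  finally show "emeasure (empirical_measure X n \<omega>) B = \<dots>" .
qed

lemma integral_empirical_measure:
  fixes g :: "real \<Rightarrow> real"
  assumes "n \<ge> 1" "g \<in> borel_measurable borel"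
  shows "(LINT x|empirical_measure X n \<omega>. g x) = empirical_mean n (\<lambda>j. X j \<omega>) g"
  using assms
  by (simp add: empirical_measure_eq_distr integral_distr integral_uniform_count_measure
      empirical_mean_def)

section \<open>Lipschitz test functions under a bounded law\<close>

lemma borel_measurable_lipschitz:
  fixes g :: "real \<Rightarrow> real"
  shows "C-lipschitz_on UNIV g \<Longrightarrow> g \<in> borel_measurable borel"
  by (intro borel_measurable_continuous_onI lipschitz_on_continuous_on)

lemma lipschitz_abs_diff_le:
  fixes g :: "real \<Rightarrow> real"
  shows "1-lipschitz_on UNIV g \<Longrightarrow> \<bar>g a - g b\<bar> \<le> \<bar>a - b\<bar>"
  using lipschitz_onD[of 1 UNIV g a b] by (simp add: dist_real_def)

lemma empirical_mean_mono:
  "(\<And>j. j \<in> {1..n} \<Longrightarrow> f (x j) \<le> g (y j)) \<Longrightarrow> empirical_mean n x f \<le> empirical_mean n y g"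
  unfolding empirical_mean_def by (intro divide_right_mono sum_mono) auto

locale bounded_law = prob_space \<mu> for \<mu> :: "real measure" +
  fixes A :: real
  assumes sets_eq [measurable_cong, simp]: "sets \<mu> = sets borel"
    and AE_bounded: "AE x in \<mu>. \<bar>x\<bar> \<le> A"
begin

lemma bound_nonneg: "0 \<le> A"
proof -
  have "AE x in \<mu>. 0 \<le> A" using AE_bounded by eventually_elim auto
  then show ?thesis by simp
qed

lemma integrable_lipschitz:
  fixes g :: "real \<Rightarrow> real"
  assumes "1-lipschitz_on UNIV g"
  shows "integrable \<mu> g"
proof (rule integrable_const_bound)
  show "AE x in \<mu>. norm (g x) \<le> \<bar>g 0\<bar> + A"
    using AE_bounded
  proof eventually_elim
    case (elim x)
    then show ?case using lipschitz_abs_diff_le[OF assms, of x 0] by simp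
  qed
  show "g \<in> borel_measurable \<mu>" using borel_measurable_lipschitz[OF assms] by simp
qed

text \<open>The test functions are not uniformly bounded, but \<open>g 0\<close> cancels: the
  empirical mean exceeds it by at most the mean of the absolute values of the sample, and the
  integral falls below it by at most A.\<close>

lemma bdd_above_empirical_kantorovich:
  assumes "n \<ge> 1"
  shows "bdd_above ((\<lambda>g. empirical_mean n x g - (LINT y|\<mu>. g y)) ` {g. 1-lipschitz_on UNIV g})"
proof (rule bdd_aboveI2)
  fix g :: "real \<Rightarrow> real" assume "g \<in> {g. 1-lipschitz_on UNIV g}"
  then have g: "1-lipschitz_on UNIV g" by simp
  have "(LINT y|\<mu>. g 0 - A) \<le> (LINT y|\<mu>. g y)"
  proof (rule integral_mono_AE)
    show "AE y in \<mu>. g 0 - A \<le> g y"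
      using AE_bounded
    proof eventually_elim
      case (elim y)
      then show ?case using lipschitz_abs_diff_le[OF g, of y 0] by simp
    qed
  qed (use integrable_lipschitz[OF g] in auto)
  then have "g 0 - A \<le> (LINT y|\<mu>. g y)" by (simp add: prob_space)
  moreover have "empirical_mean n x g \<le> empirical_mean n x (\<lambda>y. g 0 + \<bar>y\<bar>)"
    using lipschitz_abs_diff_le[OF g, of _ 0] by (intro empirical_mean_mono) (smt (verit))
  moreover have "empirical_mean n x (\<lambda>y. g 0 + \<bar>y\<bar>) = g 0 + empirical_mean n x abs"
    using assms by (simp add: empirical_mean_def sum.distrib add_divide_distrib)
  ultimately show "empirical_mean n x g - (LINT y|\<mu>. g y) \<le> A + empirical_mean n x abs"
    by linarith
qed

text \<open>Passes from the supremum in \<open>ereal\<close> to the real one. This direction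
  suffices for bounding the probability of large distances.\<close>

lemma kantorovich_empirical_measure_le:
  assumes "n \<ge> 1"
  shows "kantorovich (empirical_measure X n \<omega>) \<mu>
    \<le> ereal (empirical_kantorovich \<mu> n (\<lambda>j. X j \<omega>))"
  unfolding kantorovich_def
proof (rule SUP_least)
  fix g :: "real \<Rightarrow> real" assume g: "g \<in> {g. 1-lipschitz_on UNIV g}"
  then have "(LINT x|empirical_measure X n \<omega>. g x) = empirical_mean n (\<lambda>j. X j \<omega>) g"
    by (intro integral_empirical_measure assms borel_measurable_lipschitz) auto
  then show "ereal ((LINT x|empirical_measure X n \<omega>. g x) - (LINT x|\<mu>. g x))
      \<le> ereal (empirical_kantorovich \<mu> n (\<lambda>j. X j \<omega>))"
    using cSUP_upper[OF g bdd_above_empirical_kantorovich[OF assms]]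
    by (simp add: empirical_kantorovich_def)
qed

section \<open>The distance as a function of the sample points\<close>

lemma empirical_kantorovich_least:
  assumes "\<And>g. 1-lipschitz_on UNIV g \<Longrightarrow> empirical_mean n x g - (LINT y|\<mu>. g y) \<le> c"
  shows "empirical_kantorovich \<mu> n x \<le> c"
proof -
  \<comment> \<open>The zero function shows that the supremum is over a nonempty set.\<close>
  have "1-lipschitz_on UNIV (\<lambda>x::real. 0::real)" by (auto intro: lipschitz_onI)
  then show ?thesis unfolding empirical_kantorovich_def using assms by (intro cSUP_least) auto
qed

text \<open>For fixed g the integrals against \<mu> cancel and the empirical means differ by at most
  the average displacement. This is uniform in g, so it passes to the supremum. Continuity, the
  coordinatewise constants and boundedness along the process all come from this estimate.\<close>

lemma empirical_kantorovich_lipschitz: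
  assumes "n \<ge> 1"
  shows "\<bar>empirical_kantorovich \<mu> n x - empirical_kantorovich \<mu> n y\<bar>
    \<le> (\<Sum>j=1..n. \<bar>x j - y j\<bar>) / real n"
proof -
  have "empirical_kantorovich \<mu> n x \<le>
      empirical_kantorovich \<mu> n y + (\<Sum>j=1..n. \<bar>x j - y j\<bar>) / real n" for x y
  proof (rule empirical_kantorovich_least)
    fix g :: "real \<Rightarrow> real" assume g: "1-lipschitz_on UNIV g"
    have "g (x j) \<le> g (y j) + \<bar>x j - y j\<bar>" for j
      using lipschitz_abs_diff_le[OF g, of "x j" "y j"] by linarith
    then have "(\<Sum>j=1..n. g (x j)) \<le> (\<Sum>j=1..n. g (y j)) + (\<Sum>j=1..n. \<bar>x j - y j\<bar>)"
      unfolding sum.distrib[symmetric] by (rule sum_mono)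
    then have "empirical_mean n x g \<le> empirical_mean n y g + (\<Sum>j=1..n. \<bar>x j - y j\<bar>) / real n"
      unfolding empirical_mean_def add_divide_distrib[symmetric] by (rule divide_right_mono) simp
    moreover have "empirical_mean n y g - (LINT z|\<mu>. g z) \<le> empirical_kantorovich \<mu> n y"
      unfolding empirical_kantorovich_def
      using g by (intro cSUP_upper bdd_above_empirical_kantorovich[OF assms]) auto
    ultimately show "empirical_mean n x g - (LINT z|\<mu>. g z) \<le>
        empirical_kantorovich \<mu> n y + (\<Sum>j=1..n. \<bar>x j - y j\<bar>) / real n" by linarith
  qed
  from this[of x y] this[of y x] show ?thesis by (simp add: abs_minus_commute abs_le_iff)
qed

text \<open>In the product topology the coordinates converge one by one, and only finitely many of
  them enter the Lipschitz estimate.\<close>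

lemma continuous_empirical_kantorovich:
  assumes "n \<ge> 1"
  shows "continuous_on UNIV (empirical_kantorovich \<mu> n)"
unfolding continuous_on_def
proof safe
  show "(empirical_kantorovich \<mu> n \<longlongrightarrow> empirical_kantorovich \<mu> n x) (at x)" for x
  proof -
    have coord: "((\<lambda>y :: nat \<Rightarrow> real. y j) \<longlongrightarrow> x j) (at x)" for j
      using continuous_on_product_coordinates[of j] by (auto simp: continuous_on_def)
    have "((\<lambda>y. (\<Sum>j=1..n. \<bar>y j - x j\<bar>) / real n) \<longlongrightarrow>
        (\<Sum>j=1..n. \<bar>x j - x j\<bar>) / real n) (at x)"
      using assms by (intro tendsto_intros coord) auto
    then have "((\<lambda>y. (\<Sum>j=1..n. \<bar>y j - x j\<bar>) / real n) \<longlongrightarrow> 0) (at x)" by simp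
    then have "((\<lambda>y. empirical_kantorovich \<mu> n y - empirical_kantorovich \<mu> n x) \<longlongrightarrow> 0) (at x)"
      by (rule Lim_null_comparison[rotated])
        (intro always_eventually allI, unfold real_norm_def,
          rule empirical_kantorovich_lipschitz[OF assms])
    then show ?thesis by (rule LIM_zero_cancel)
  qed
qed

text \<open>The supremum is over an uncountable family, so measurability is obtained from
  continuity.\<close>

lemma borel_measurable_empirical_kantorovich:
  assumes n: "n \<ge> 1" and X: "\<And>j. j \<ge> 1 \<Longrightarrow> X j \<in> borel_measurable M"
  shows "(\<lambda>\<omega>. empirical_kantorovich \<mu> n (\<lambda>j\<in>{1..n}. X j \<omega>)) \<in> borel_measurable M"
proof -
  have "(\<lambda>\<omega>. \<lambda>j\<in>{1..n}. X j \<omega>) \<in> M \<rightarrow>\<^sub>M borel"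
  proof (rule measurable_coordinatewise_then_product)
    \<comment> \<open>For i outside {1..n} the coordinate is the constant
      \<open>undefined\<close>.\<close>
    show "(\<lambda>\<omega>. (\<lambda>j\<in>{1..n}. X j \<omega>) i) \<in> borel_measurable M" for i
      using X by (cases "i \<in> {1..n}") auto
  qed
  then show ?thesis
    by (rule measurable_compose)
      (intro borel_measurable_continuous_onI continuous_empirical_kantorovich n)
qed

lemma empirical_kantorovich_restrict:
  "empirical_kantorovich \<mu> n (\<lambda>j\<in>{1..n}. x j) = empirical_kantorovich \<mu> n x"
  by (simp add: empirical_kantorovich_def empirical_mean_def)

text \<open>Moving one coordinate changes one of n summands, hence the constant 1/n. Nonnegativity
  allows the bound to be squared.\<close>

lemma
  assumes n: "n \<ge> 1" and j: "j \<in> {1..n}"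
  shows bdd_above_coord_quotients: "bdd_above (coord_quotients n 1 (empirical_kantorovich \<mu> n) j)"
    and coord_holder_const_le: "coord_holder_const n 1 (empirical_kantorovich \<mu> n) j \<le> 1 / real n"
    and coord_holder_const_nonneg: "0 \<le> coord_holder_const n 1 (empirical_kantorovich \<mu> n) j"
proof -
  let ?K = "empirical_kantorovich \<mu> n"
  have le: "q \<le> 1 / real n" if "q \<in> coord_quotients n 1 ?K j" for q
  proof -
    from that obtain x y where q: "q = \<bar>?K x - ?K (x(j := y))\<bar> / \<bar>x j - y\<bar>" and y: "y \<noteq> x j"
      by (auto simp: coord_quotients_def)
    have "(\<Sum>i=1..n. \<bar>x i - (x(j := y)) i\<bar>) = (\<Sum>i=1..n. if i = j then \<bar>x j - y\<bar> else 0)"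
      by (intro sum.cong) auto
    then have "\<bar>?K x - ?K (x(j := y))\<bar> \<le> \<bar>x j - y\<bar> / real n"
      using empirical_kantorovich_lipschitz[OF n, of x "x(j := y)"] j by simp
    then show ?thesis using y n by (simp add: q field_simps)
  qed
  then show bdd: "bdd_above (coord_quotients n 1 ?K j)" by (rule bdd_aboveI)
  obtain q where q: "q \<in> coord_quotients n 1 ?K j" "q \<ge> 0"
  proof
    let ?x = "\<lambda>i\<in>{1..n}. 0 :: real"
    show "\<bar>?K ?x - ?K (?x(j := 1))\<bar> / \<bar>?x j - 1\<bar> powr 1 \<in> coord_quotients n 1 ?K j"
      unfolding coord_quotients_def
      using j by (intro CollectI exI[of _ ?x] exI[of _ 1]) auto
  qed simp
  show "coord_holder_const n 1 ?K j \<le> 1 / real n"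
    unfolding coord_holder_const_def using q le by (intro cSup_least) auto
  show "0 \<le> coord_holder_const n 1 ?K j"
    unfolding coord_holder_const_def using cSup_upper[OF q(1) bdd] q(2) by linarith
qed

text \<open>Replaces the supremum over all g by N fixed functions. Interpolating g costs 2 \<delta>
  in the empirical mean and 2 \<delta> in the integral. The coefficients depend on g, but are at
  most \<delta> in absolute value, so the resulting bound does not depend on g.\<close>

lemma empirical_kantorovich_le_ramps:
  assumes n: "n \<ge> 1" and \<delta>: "\<delta> > 0" and N: "2 * A \<le> real N * \<delta>"
    and x: "\<And>j. j \<in> {1..n} \<Longrightarrow> \<bar>x j\<bar> \<le> A"
  defines "r \<equiv> \<lambda>k. ramp \<delta> (- A + real k * \<delta>)"
  shows "empirical_kantorovich \<mu> n x
    \<le> 4 * \<delta> + \<delta> * (\<Sum>k<N. \<bar>empirical_mean n x (r k) - (LINT y|\<mu>. r k y)\<bar>)"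
proof (rule empirical_kantorovich_least)
  fix g :: "real \<Rightarrow> real" assume g: "1-lipschitz_on UNIV g"
  define d where "d k = g (- A + real (Suc k) * \<delta>) - g (- A + real k * \<delta>)" for k
  define G where "G y = g (- A) + (\<Sum>k<N. d k * r k y)" for y
  have d: "\<bar>d k\<bar> \<le> \<delta>" for k
    using lipschitz_abs_diff_le[OF g, of "- A + real (Suc k) * \<delta>" "- A + real k * \<delta>"] \<delta>
    by (simp add: d_def algebra_simps)
  \<comment> \<open>The cells start at -A, and by \<open>N\<close> they reach at least A.\<close>
  have approx: "\<bar>g y - G y\<bar> \<le> 2 * \<delta>" if "\<bar>y\<bar> \<le> A" for y
    unfolding G_def d_def r_def using that N by (intro ramp_interpolation[OF g \<delta>]) auto
  have int_r: "integrable \<mu> (r k)" for k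
    unfolding r_def
    by (rule integrable_const_bound[where B=1]) (auto simp: ramp_nonneg ramp_le_1)
  then have int_G: "integrable \<mu> G" unfolding G_def [abs_def] by auto
  have mean_G: "empirical_mean n x G = g (- A) + (\<Sum>k<N. d k * empirical_mean n x (r k))"
  proof -
    have "(\<Sum>j=1..n. \<Sum>k<N. d k * r k (x j)) = (\<Sum>k<N. d k * (\<Sum>j=1..n. r k (x j)))"
      by (subst sum.swap) (simp add: sum_distrib_left)
    then show ?thesis
      using n by (simp add: empirical_mean_def G_def sum.distrib add_divide_distrib
          sum_divide_distrib sum_distrib_left)
  qed
  have int_G_eq: "(LINT y|\<mu>. G y) = g (- A) + (\<Sum>k<N. d k * (LINT y|\<mu>. r k y))"
    using int_r by (simp add: G_def prob_space)
  have "empirical_mean n x g \<le> empirical_mean n x (\<lambda>y. G y + 2 * \<delta>)"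
    using approx x by (intro empirical_mean_mono) (smt (verit))
  also have "\<dots> = empirical_mean n x G + 2 * \<delta>"
    using n by (simp add: empirical_mean_def sum.distrib add_divide_distrib)
  finally have 1: "empirical_mean n x g \<le> empirical_mean n x G + 2 * \<delta>" .
  have "(LINT y|\<mu>. G y) \<le> (LINT y|\<mu>. g y + 2 * \<delta>)"
  proof (rule integral_mono_AE)
    show "AE y in \<mu>. G y \<le> g y + 2 * \<delta>"
      using AE_bounded
    proof eventually_elim
      case (elim y)
      then show ?case using approx[of y] by linarith
    qed
  qed (use integrable_lipschitz[OF g] int_G in auto)
  also have "\<dots> = (LINT y|\<mu>. g y) + 2 * \<delta>"
    using integrable_lipschitz[OF g] by (simp add: prob_space)
  finally have 2: "(LINT y|\<mu>. G y) \<le> (LINT y|\<mu>. g y) + 2 * \<delta>" .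
  have "empirical_mean n x G - (LINT y|\<mu>. G y)
      = (\<Sum>k<N. d k * (empirical_mean n x (r k) - (LINT y|\<mu>. r k y)))"
    by (simp add: mean_G int_G_eq sum_subtractf right_diff_distrib)
  also have "\<dots> \<le> (\<Sum>k<N. \<delta> * \<bar>empirical_mean n x (r k) - (LINT y|\<mu>. r k y)\<bar>)"
  proof (rule sum_mono)
    fix k
    have "d k * (empirical_mean n x (r k) - (LINT y|\<mu>. r k y))
      \<le> \<bar>d k\<bar> * \<bar>empirical_mean n x (r k) - (LINT y|\<mu>. r k y)\<bar>"
      unfolding abs_mult[symmetric] by simp
    also have "\<dots> \<le> \<delta> * \<bar>empirical_mean n x (r k) - (LINT y|\<mu>. r k y)\<bar>"
      using d by (intro mult_right_mono) auto
    finally show "d k * (empirical_mean n x (r k) - (LINT y|\<mu>. r k y))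
      \<le> \<delta> * \<bar>empirical_mean n x (r k) - (LINT y|\<mu>. r k y)\<bar>" .
  qed
  finally show "empirical_mean n x g - (LINT y|\<mu>. g y)
      \<le> 4 * \<delta> + \<delta> * (\<Sum>k<N. \<bar>empirical_mean n x (r k) - (LINT y|\<mu>. r k y)\<bar>)"
    using 1 2 by (simp add: sum_distrib_left)
qed

end

section \<open>Variance of empirical means of a stationary process\<close>

text \<open>Stationarity is invariance under a single shift, so induction on i moves the pair of
  times back to 1 and \<open>Suc m\<close>. Coordinate i of the path is
  \<open>X (Suc i)\<close>.\<close>

lemma stationary_expectation_shift:
  fixes f :: "real \<Rightarrow> real \<Rightarrow> real"
  assumes X: "\<And>k. k \<ge> 1 \<Longrightarrow> X k \<in> borel_measurable M"
    and stat: "stationary_process M X"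
    and f [measurable]: "case_prod f \<in> borel_measurable (borel \<Otimes>\<^sub>M borel)"
  shows "(LINT \<omega>|M. f (X (Suc i) \<omega>) (X (Suc (i + m)) \<omega>)) = (LINT \<omega>|M. f (X 1 \<omega>) (X (Suc m) \<omega>))"
proof (induction i)
  case 0
  show ?case by simp
next
  case (Suc i)
  let ?P = "PiM UNIV (\<lambda>_ :: nat. borel :: real measure)"
  have path [measurable]: "path X \<in> M \<rightarrow>\<^sub>M ?P"
    unfolding path_def by (intro measurable_PiM_single') (auto intro: X)
  have shift [measurable]: "shift \<in> ?P \<rightarrow>\<^sub>M ?P"
    unfolding shift_def by (intro measurable_PiM_single') auto
  let ?f = "\<lambda>x. f (x i) (x (i + m))"
  have fm [measurable]: "?f \<in> borel_measurable ?P" by measurable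
  have law: "(LINT x|process_law M X. h x) = (LINT \<omega>|M. h (path X \<omega>))"
    if "h \<in> borel_measurable ?P" for h :: "_ \<Rightarrow> real"
    unfolding process_law_def using that by (intro integral_distr path)
  have "(LINT \<omega>|M. ?f (path X \<omega>)) = (LINT x|distr (process_law M X) ?P shift. ?f x)"
    using stat law[OF fm] by (simp add: stationary_process_def)
  also have "\<dots> = (LINT x|process_law M X. ?f (shift x))"
    by (intro integral_distr) (auto simp: process_law_def)
  also have "\<dots> = (LINT \<omega>|M. ?f (shift (path X \<omega>)))"
    by (intro law) measurable
  finally show ?case using Suc by (simp add: path_def shift_def)
qed

text \<open>Both factors have mean zero, so expanding the product leaves the mixed moment minus the
  squared mean. In \<open>autocov\<close> the index 1 stands for the variance, so a time difference
  l has index \<open>Suc l\<close>.\<close>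

lemma stationary_centered_second_moment:
  fixes u :: "real \<Rightarrow> real"
  assumes "prob_space M"
    and X: "\<And>k. k \<ge> 1 \<Longrightarrow> X k \<in> borel_measurable M"
    and stat: "stationary_process M X"
    and law: "\<And>k. k \<ge> 1 \<Longrightarrow> distr M borel (X k) = \<mu>"
    and u [measurable]: "u \<in> borel_measurable borel" and bounded: "\<And>x. \<bar>u x\<bar> \<le> B"
  shows "(LINT \<omega>|M. (u (X (Suc i) \<omega>) - (LINT x|\<mu>. u x)) * (u (X (Suc (i + l)) \<omega>) - (LINT x|\<mu>. u x)))
    = autocov M X u (Suc l)"
proof -
  interpret prob_space M by fact
  have [measurable]: "X (Suc k) \<in> borel_measurable M" for k using X by simp
  have int: "integrable M (\<lambda>\<omega>. u (X (Suc k) \<omega>))" for k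
    by (rule integrable_const_bound[where B=B]) (auto simp: bounded)
  have mean: "(LINT \<omega>|M. u (X (Suc k) \<omega>)) = (LINT x|\<mu>. u x)" for k
    using integral_distr[of "X (Suc k)" M borel u] law[of "Suc k"] by simp
  have int2: "integrable M (\<lambda>\<omega>. u (X (Suc i) \<omega>) * u (X (Suc k) \<omega>))" for i k
    by (rule integrable_const_bound[where B="B * B"])
      (auto simp: abs_mult intro!: mult_mono bounded order_trans[OF abs_ge_zero bounded])
  define m where "m = (LINT x|\<mu>. u x)"
  have "(LINT \<omega>|M. (u (X (Suc i) \<omega>) - m) * (u (X (Suc (i + l)) \<omega>) - m)) =
      (LINT \<omega>|M. u (X (Suc i) \<omega>) * u (X (Suc (i + l)) \<omega>) - m * u (X (Suc i) \<omega>)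
        - m * u (X (Suc (i + l)) \<omega>) + m * m)"
    by (simp add: algebra_simps)
  also have "\<dots> = (LINT \<omega>|M. u (X (Suc i) \<omega>) * u (X (Suc (i + l)) \<omega>)) - m\<^sup>2"
    using int int2 mean by (simp add: m_def prob_space power2_eq_square)
  also have "(LINT \<omega>|M. u (X (Suc i) \<omega>) * u (X (Suc (i + l)) \<omega>)) =
      (LINT \<omega>|M. u (X 1 \<omega>) * u (X (Suc l) \<omega>))"
    by (rule stationary_expectation_shift[OF X stat]) auto
  finally show ?thesis using mean[of 0] by (simp add: autocov_def m_def)
qed

text \<open>In row i, the entries with j < i and those with j \<ge> i each have distinct distances
  to i. Each half is thus at most the full series, and there are n rows.\<close>

lemma sum_symmetric_kernel_le:
  fixes c :: "nat \<Rightarrow> real"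
  assumes "summable c" and nonneg: "\<And>l. c l \<ge> 0"
  shows "(\<Sum>i<n. \<Sum>j<n. c (if i \<le> j then j - i else i - j)) \<le> 2 * real n * (\<Sum>l. c l)"
proof -
  have inner: "(\<Sum>j<n. c (if i \<le> j then j - i else i - j)) \<le> 2 * (\<Sum>l. c l)" if "i < n" for i
  proof -
    have le: "sum c L \<le> (\<Sum>l. c l)" if "finite L" for L
      by (rule sum_le_suminf[OF assms(1) that nonneg])
    have split: "{..<n} = {..<i} \<union> {i..<n}" using that by auto
    have "(\<Sum>j<n. c (if i \<le> j then j - i else i - j)) =
        (\<Sum>j<i. c (if i \<le> j then j - i else i - j)) + (\<Sum>j=i..<n. c (if i \<le> j then j - i else i - j))"
      unfolding split by (rule sum.union_disjoint) auto
    also have "(\<Sum>j<i. c (if i \<le> j then j - i else i - j)) = sum c ((\<lambda>j. i - j) ` {..<i})"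
      by (subst sum.reindex) (auto simp: inj_on_def intro!: sum.cong)
    also have "(\<Sum>j=i..<n. c (if i \<le> j then j - i else i - j)) = sum c ((\<lambda>j. j - i) ` {i..<n})"
      by (subst sum.reindex) (auto simp: inj_on_def intro!: sum.cong)
    finally show ?thesis
      using le[of "(\<lambda>j. i - j) ` {..<i}"] le[of "(\<lambda>j. j - i) ` {i..<n}"] by simp
  qed
  have "(\<Sum>i<n. \<Sum>j<n. c (if i \<le> j then j - i else i - j)) \<le> (\<Sum>i<n. 2 * (\<Sum>l. c l))"
    using inner by (intro sum_mono) auto
  then show ?thesis by (simp add: mult_ac)
qed

text \<open>The squared sum expands into covariances depending only on the time difference. Their
  double sum is at most 2 n times the series, which is then divided by the square of n.\<close>

lemma empirical_mean_second_moment_le: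
  fixes u :: "real \<Rightarrow> real"
  assumes "prob_space M"
    and X: "\<And>k. k \<ge> 1 \<Longrightarrow> X k \<in> borel_measurable M"
    and stat: "stationary_process M X"
    and law: "\<And>k. k \<ge> 1 \<Longrightarrow> distr M borel (X k) = \<mu>"
    and u [measurable]: "u \<in> borel_measurable borel" and bounded: "\<And>x. \<bar>u x\<bar> \<le> B"
    and summable: "summable (\<lambda>l. \<bar>autocov M X u (Suc l)\<bar>)"
    and n: "n \<ge> 1"
  shows "(LINT \<omega>|M. (empirical_mean n (\<lambda>j. X j \<omega>) u - (LINT x|\<mu>. u x))\<^sup>2)
    \<le> 2 * (\<Sum>l. \<bar>autocov M X u (Suc l)\<bar>) / real n"
proof -
  interpret prob_space M by fact
  have [measurable]: "X (Suc k) \<in> borel_measurable M" for k using X by simp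
  define Y where "Y k \<omega> = u (X (Suc k) \<omega>) - (LINT x|\<mu>. u x)" for k \<omega>
  have Ym [measurable]: "Y k \<in> borel_measurable M" for k unfolding Y_def by measurable
  define B' where "B' = B + \<bar>LINT x|\<mu>. u x\<bar>"
  have Yb: "\<bar>Y k \<omega>\<bar> \<le> B'" for k \<omega>
    using bounded[of "X (Suc k) \<omega>"] unfolding Y_def B'_def by linarith
  have int: "integrable M (\<lambda>\<omega>. Y i \<omega> * Y k \<omega>)" for i k
    by (rule integrable_const_bound[where B="B' * B'"])
      (auto simp: abs_mult intro!: mult_mono Yb order_trans[OF abs_ge_zero Yb])
  have cov: "(LINT \<omega>|M. Y i \<omega> * Y k \<omega>) = autocov M X u (Suc (if i \<le> k then k - i else i - k))"
    for i k
  proof (cases "i \<le> k")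
    case True
    then show ?thesis
      using stationary_centered_second_moment[OF assms(1) X stat law u bounded, of i "k - i"]
      by (simp add: Y_def)
  next
    case False
    then show ?thesis
      using stationary_centered_second_moment[OF assms(1) X stat law u bounded, of k "i - k"]
      by (simp add: Y_def mult.commute)
  qed
  have mean: "empirical_mean n (\<lambda>j. X j \<omega>) u - (LINT x|\<mu>. u x) = (\<Sum>k<n. Y k \<omega>) / real n" for \<omega>
  proof -
    have "(\<Sum>j=1..n. u (X j \<omega>)) = (\<Sum>k<n. u (X (Suc k) \<omega>))"
      by (simp add: sum.atLeast1_atMost_eq)
    then show ?thesis using n by (simp add: empirical_mean_def Y_def sum_subtractf field_simps)
  qed
  have "(LINT \<omega>|M. (empirical_mean n (\<lambda>j. X j \<omega>) u - (LINT x|\<mu>. u x))\<^sup>2) =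
      (LINT \<omega>|M. (\<Sum>i<n. \<Sum>k<n. Y i \<omega> * Y k \<omega>) / (real n)\<^sup>2)"
    by (simp add: mean power_divide power2_eq_square[of "sum _ _"] sum_product)
  also have "\<dots> = (\<Sum>i<n. \<Sum>k<n. autocov M X u (Suc (if i \<le> k then k - i else i - k))) / (real n)\<^sup>2"
    using int by (simp only: integral_divide_zero Bochner_Integration.integral_sum
        Bochner_Integration.integrable_sum cov)
  also have "\<dots> \<le> (\<Sum>i<n. \<Sum>k<n. \<bar>autocov M X u (Suc (if i \<le> k then k - i else i - k))\<bar>) / (real n)\<^sup>2"
    by (intro divide_right_mono sum_mono) auto
  also have "\<dots> \<le> 2 * real n * (\<Sum>l. \<bar>autocov M X u (Suc l)\<bar>) / (real n)\<^sup>2"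
    using sum_symmetric_kernel_le[OF summable, of n] by (intro divide_right_mono) auto
  also have "\<dots> = 2 * (\<Sum>l. \<bar>autocov M X u (Suc l)\<bar>) / real n"
    using n by (simp add: power2_eq_square)
  finally show ?thesis .
qed

text \<open>This is nonnegativity of the variance of |S|.\<close>

lemma (in prob_space) expectation_abs_le_sqrt:
  assumes "random_variable borel S" and bounded: "\<And>\<omega>. \<bar>S \<omega>\<bar> \<le> (B :: real)"
  shows "expectation (\<lambda>\<omega>. \<bar>S \<omega>\<bar>) \<le> sqrt (expectation (\<lambda>\<omega>. (S \<omega>)\<^sup>2))"
proof -
  have [measurable]: "S \<in> borel_measurable M" by fact
  have 1: "integrable M (\<lambda>\<omega>. \<bar>S \<omega>\<bar>)"
    by (rule integrable_const_bound[where B=B]) (auto simp: bounded)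
  have 2: "integrable M (\<lambda>\<omega>. \<bar>S \<omega>\<bar>\<^sup>2)"
    by (rule integrable_const_bound[where B="B\<^sup>2"]) (auto intro!: power2_le_iff_abs_le[THEN iffD2]
        simp: bounded order_trans[OF abs_ge_zero bounded])
  have "0 \<le> variance (\<lambda>\<omega>. \<bar>S \<omega>\<bar>)" by simp
  also have "\<dots> = expectation (\<lambda>\<omega>. \<bar>S \<omega>\<bar>\<^sup>2) - (expectation (\<lambda>\<omega>. \<bar>S \<omega>\<bar>))\<^sup>2"
    by (rule variance_eq[OF 1 2])
  finally show ?thesis by (intro real_le_rsqrt) simp
qed

section \<open>Concentration around the mean and bound on the mean\<close>

text \<open>The Devroye inequality and the covariance bound are left to the individual lemmas: the
  first controls the fluctuation of the distance, the second its mean.\<close>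

locale bounded_stationary_process = prob_space M for M :: "'a measure" +
  fixes X :: "nat \<Rightarrow> 'a \<Rightarrow> real" and \<mu> :: "real measure" and A :: real
  assumes measurable_X: "\<And>k. k \<ge> 1 \<Longrightarrow> X k \<in> borel_measurable M"
    and stationary: "stationary_process M X"
    and law: "\<And>k. k \<ge> 1 \<Longrightarrow> distr M borel (X k) = \<mu>"
    and AE_X_bounded: "\<And>k. k \<ge> 1 \<Longrightarrow> AE \<omega> in M. \<bar>X k \<omega>\<bar> \<le> A"

sublocale bounded_stationary_process \<subseteq> law: bounded_law \<mu> A
proof -
  have X1: "X 1 \<in> borel_measurable M" by (rule measurable_X) simp
  have law1: "distr M borel (X 1) = \<mu>" by (rule law) simp
  interpret \<mu>: prob_space \<mu>
    using prob_space_distr[OF X1] unfolding law1 .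
  show "bounded_law \<mu> A"
  proof
    show "sets \<mu> = sets borel" unfolding law1[symmetric] by (rule sets_distr)
    have "AE x in distr M borel (X 1). \<bar>x\<bar> \<le> A"
      using AE_X_bounded[of 1] X1 by (subst AE_distr_iff) auto
    then show "AE x in \<mu>. \<bar>x\<bar> \<le> A" unfolding law1 .
  qed
qed

context bounded_stationary_process
begin

section \<open>Moments and deviations of the distance along the process\<close>

definition distance :: "nat \<Rightarrow> 'a \<Rightarrow> real" where
  "distance n \<omega> = empirical_kantorovich \<mu> n (\<lambda>j. X j \<omega>)"

lemma borel_measurable_distance: "n \<ge> 1 \<Longrightarrow> distance n \<in> borel_measurable M"
  using law.borel_measurable_empirical_kantorovich[OF _ measurable_X]
  unfolding law.empirical_kantorovich_restrict distance_def .

lemma AE_all_bounded: "AE \<omega> in M. \<forall>j\<in>{1..n}. \<bar>X j \<omega>\<bar> \<le> A"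
  using AE_X_bounded by (intro AE_finite_allI) auto

text \<open>Compares the sample with the zero sample through the Lipschitz estimate. This yields the
  integrability that Chebyshev's inequality requires.\<close>

lemma AE_distance_bounded:
  assumes "n \<ge> 1"
  shows "AE \<omega> in M. \<bar>distance n \<omega>\<bar> \<le> \<bar>empirical_kantorovich \<mu> n (\<lambda>_. 0)\<bar> + A"
  using AE_all_bounded[of n]
proof eventually_elim
  case (elim \<omega>)
  have "(\<Sum>j=1..n. \<bar>X j \<omega> - 0\<bar>) / real n \<le> (\<Sum>j=1..n. A) / real n"
    using elim by (intro divide_right_mono sum_mono) auto
  then have "(\<Sum>j=1..n. \<bar>X j \<omega> - 0\<bar>) / real n \<le> A" using assms by simp
  then show ?case
    using law.empirical_kantorovich_lipschitz[OF assms, of "\<lambda>j. X j \<omega>" "\<lambda>_. 0"]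
    unfolding distance_def by linarith
qed

lemma
  assumes "n \<ge> 1"
  shows integrable_distance: "integrable M (distance n)"
    and integrable_distance_square: "integrable M (\<lambda>\<omega>. (distance n \<omega>)\<^sup>2)"
proof -
  note [measurable] = borel_measurable_distance[OF assms]
  let ?B = "\<bar>empirical_kantorovich \<mu> n (\<lambda>_. 0)\<bar> + A"
  show "integrable M (distance n)"
    using AE_distance_bounded[OF assms] by (intro integrable_const_bound[where B="?B"]) auto
  have "AE \<omega> in M. norm ((distance n \<omega>)\<^sup>2) \<le> ?B\<^sup>2"
    using AE_distance_bounded[OF assms]
  proof eventually_elim
    case (elim \<omega>)
    then have "\<bar>distance n \<omega>\<bar>\<^sup>2 \<le> ?B\<^sup>2" by (intro power_mono) auto
    then show ?case by simp
  qed
  then show "integrable M (\<lambda>\<omega>. (distance n \<omega>)\<^sup>2)"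
    by (intro integrable_const_bound) auto
qed

text \<open>Each of the n coordinates contributes at most the square of 1/n.\<close>

lemma variance_distance_le:
  assumes dev: "devroye_inequality M X D" and n: "n \<ge> 1"
  shows "variance (distance n) \<le> D 1 / real n"
proof -
  have D: "D 1 > 0" using dev by (auto simp: devroye_inequality_def)
  have "separately_holder n 1 (empirical_kantorovich \<mu> n)"
    unfolding separately_holder_def using law.bdd_above_coord_quotients[OF n] by simp
  then have "variance (\<lambda>\<omega>. empirical_kantorovich \<mu> n (\<lambda>j\<in>{1..n}. X j \<omega>))
      \<le> D 1 * (\<Sum>j=1..n. (coord_holder_const n 1 (empirical_kantorovich \<mu> n) j)\<^sup>2)"
    using dev n by (simp add: devroye_inequality_def)
  also have "\<dots> \<le> D 1 * (\<Sum>j=1..n. (1 / real n)\<^sup>2)"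
    using D law.coord_holder_const_le[OF n] law.coord_holder_const_nonneg[OF n]
    by (intro mult_left_mono sum_mono power_mono) auto
  also have "\<dots> = D 1 / real n" using n by (simp add: power2_eq_square field_simps)
  finally show ?thesis
    unfolding law.empirical_kantorovich_restrict distance_def .
qed

text \<open>As b dominates the mean, a distance above t + b is a deviation of at least t from the
  mean, to which Chebyshev's inequality applies.\<close>

lemma deviation_distance_le:
  assumes dev: "devroye_inequality M X D" and n: "n \<ge> 1" and t: "t > 0"
    and mean: "expectation (distance n) \<le> b"
  shows "prob {\<omega> \<in> space M. kantorovich (empirical_measure X n \<omega>) \<mu> > ereal (t + b)}
    \<le> D 1 / (real n * t\<^sup>2)"
proof -
  note [measurable] = borel_measurable_distance[OF n]
  have "prob {\<omega> \<in> space M. kantorovich (empirical_measure X n \<omega>) \<mu> > ereal (t + b)}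
    \<le> prob {\<omega> \<in> space M. t \<le> \<bar>distance n \<omega> - expectation (distance n)\<bar>}"
  \<comment> \<open>Monotonicity asks for measurability of the larger event, which is supplied by
    that of \<open>distance n\<close>.\<close>
  proof (rule finite_measure_mono)
    show "{\<omega> \<in> space M. kantorovich (empirical_measure X n \<omega>) \<mu> > ereal (t + b)}
      \<subseteq> {\<omega> \<in> space M. t \<le> \<bar>distance n \<omega> - expectation (distance n)\<bar>}"
    proof safe
      fix \<omega>
      assume "kantorovich (empirical_measure X n \<omega>) \<mu> > ereal (t + b)"
      then have "ereal (t + b) < ereal (distance n \<omega>)"
        using law.kantorovich_empirical_measure_le[OF n, of X \<omega>] unfolding distance_def
        by (rule order_less_le_trans)
      then show "t \<le> \<bar>distance n \<omega> - expectation (distance n)\<bar>" using mean by simp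
    qed
  qed measurable
  also have "\<dots> \<le> variance (distance n) / t\<^sup>2"
    by (intro Chebyshev_inequality integrable_distance_square n t borel_measurable_distance)
  also have "\<dots> \<le> (D 1 / real n) / t\<^sup>2"
    by (intro divide_right_mono variance_distance_le[OF dev n]) simp
  finally show ?thesis by simp
qed

text \<open>Each ramp contributes \<delta> times its mean absolute fluctuation, bounded uniformly in
  k. As N \<delta> is bounded, the sum is of the order of one such fluctuation.\<close>

lemma expectation_distance_le:
  assumes \<eta>: "\<eta> \<in> {0<..1}" and C: "C > 0"
    and summable: "\<And>u. holder_continuous \<eta> u \<Longrightarrow> summable (\<lambda>l. \<bar>autocov M X u (Suc l)\<bar>)"
    and suminf_le: "\<And>u. holder_continuous \<eta> u \<Longrightarrow>
      (\<Sum>l. \<bar>autocov M X u (Suc l)\<bar>) \<le> C * (holder_const \<eta> u)\<^sup>2"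
    and n: "n \<ge> 1"
  shows "expectation (distance n)
    \<le> (4 + (2 * A + 1) * sqrt (2 * C)) / real n powr (1 / (2 * (1 + \<eta>)))"
proof -
  \<comment> \<open>The solution of \<beta> * \<eta> - 1/2 = - \<beta>, which makes the order of a
    ramp's fluctuation equal to the mesh \<delta>.\<close>
  define \<beta> where "\<beta> = 1 / (2 * (1 + \<eta>))"
  define \<delta> where "\<delta> = real n powr - \<beta>"
  \<comment> \<open>Enough cells to cover [-A, A]. Rounding up adds at most one cell, of length
    \<delta> \<le> 1, whence the bound 2 * A + 1 on the total length.\<close>
  define N where "N = nat \<lceil>2 * A / \<delta>\<rceil>"
  have \<delta>: "\<delta> > 0" using n by (simp add: \<delta>_def)
  have \<delta>_le_1: "\<delta> \<le> 1"
    using n \<eta> by (auto simp: \<delta>_def \<beta>_def powr_minus intro!: inverse_le_1_iff[THEN iffD2]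
        ge_one_powr_ge_zero)
  have A: "0 \<le> A" by (rule law.bound_nonneg)
  have "2 * A / \<delta> \<le> real N" unfolding N_def by linarith
  then have N_ge: "2 * A \<le> real N * \<delta>" using \<delta> by (simp add: field_simps)
  have "real N \<le> 2 * A / \<delta> + 1" using A \<delta> unfolding N_def by simp
  then have "real N * \<delta> \<le> 2 * A + \<delta>" using \<delta> by (simp add: field_simps)
  then have N_le: "real N * \<delta> \<le> 2 * A + 1" using \<delta>_le_1 by linarith
  define r where "r k = ramp \<delta> (- A + real k * \<delta>)" for k
  define S where "S k \<omega> = empirical_mean n (\<lambda>j. X j \<omega>) (r k) - (LINT y|\<mu>. r k y)" for k \<omega>
  have rb: "\<bar>r k y\<bar> \<le> 1" for k y by (simp add: r_def ramp_nonneg ramp_le_1)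
  have Sm [measurable]: "S k \<in> borel_measurable M" for k
  proof -
    have "(\<lambda>\<omega>. r k (X j \<omega>)) \<in> borel_measurable M" if "j \<in> {1..n}" for j
      unfolding r_def
      using that by (intro measurable_compose[OF measurable_X borel_measurable_ramp]) auto
    then show ?thesis unfolding S_def empirical_mean_def by measurable
  qed
  have Sb: "\<bar>S k \<omega>\<bar> \<le> 1 + \<bar>LINT y|\<mu>. r k y\<bar>" for k \<omega>
  proof -
    have "\<bar>\<Sum>j=1..n. r k (X j \<omega>)\<bar> \<le> (\<Sum>j=1..n. 1)"
      by (rule order_trans[OF sum_abs]) (intro sum_mono rb)
    then have "\<bar>empirical_mean n (\<lambda>j. X j \<omega>) (r k)\<bar> \<le> 1"
      using n by (simp add: empirical_mean_def)
    then show ?thesis unfolding S_def by linarith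
  qed
  \<comment> \<open>The first absolute moment is bounded by the root of the second, to which the
    covariance bound applies with the Hoelder constant of a ramp.\<close>
  have ES: "expectation (\<lambda>\<omega>. \<bar>S k \<omega>\<bar>) \<le> sqrt (2 * C) * \<delta> powr - \<eta> / sqrt (real n)" for k
  proof -
    have hc: "holder_continuous \<eta> (r k)"
      unfolding r_def by (rule holder_continuous_ramp[OF \<delta> \<eta>])
    have "expectation (\<lambda>\<omega>. (S k \<omega>)\<^sup>2) \<le> 2 * (\<Sum>l. \<bar>autocov M X (r k) (Suc l)\<bar>) / real n"
      unfolding S_def
      by (rule empirical_mean_second_moment_le[OF prob_space_axioms measurable_X stationary law _ rb
            summable[OF hc] n])
        (auto simp: r_def)
    also have "\<dots> \<le> 2 * (C * (\<delta> powr - \<eta>)\<^sup>2) / real n"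
    proof (intro divide_right_mono mult_left_mono order_trans[OF suminf_le[OF hc]] power_mono)
      show "holder_const \<eta> (r k) \<le> \<delta> powr - \<eta>" "0 \<le> holder_const \<eta> (r k)"
        unfolding r_def by (rule holder_const_ramp_le[OF \<delta> \<eta>] holder_const_ramp_nonneg[OF \<delta> \<eta>])+
    qed (use C in auto)
    finally have "sqrt (expectation (\<lambda>\<omega>. (S k \<omega>)\<^sup>2)) \<le> sqrt (2 * C * (\<delta> powr - \<eta>)\<^sup>2 / real n)"
      by simp
    also have "\<dots> = sqrt (2 * C) * \<delta> powr - \<eta> / sqrt (real n)"
      by (simp add: real_sqrt_divide real_sqrt_mult)
    finally show ?thesis using expectation_abs_le_sqrt[OF Sm Sb] by (rule order_trans[rotated])
  qed
  have int_S: "integrable M (\<lambda>\<omega>. \<bar>S k \<omega>\<bar>)" for k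
    by (rule integrable_const_bound[where B="1 + \<bar>LINT y|\<mu>. r k y\<bar>"]) (auto simp: Sb)
  have "expectation (distance n) \<le> expectation (\<lambda>\<omega>. 4 * \<delta> + \<delta> * (\<Sum>k<N. \<bar>S k \<omega>\<bar>))"
  proof (rule integral_mono_AE)
    show "AE \<omega> in M. distance n \<omega> \<le> 4 * \<delta> + \<delta> * (\<Sum>k<N. \<bar>S k \<omega>\<bar>)"
      using AE_all_bounded[of n]
    proof eventually_elim
      case (elim \<omega>)
      then show ?case unfolding distance_def S_def r_def
        by (intro law.empirical_kantorovich_le_ramps n \<delta> N_ge) auto
    qed
  qed (use integrable_distance[OF n] int_S in auto)
  also have "\<dots> = 4 * \<delta> + \<delta> * (\<Sum>k<N. expectation (\<lambda>\<omega>. \<bar>S k \<omega>\<bar>))"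
    using int_S by (simp add: prob_space)
  also have "\<dots> \<le> 4 * \<delta> + \<delta> * (\<Sum>k<N. sqrt (2 * C) * \<delta> powr - \<eta> / sqrt (real n))"
    using \<delta> by (intro add_left_mono mult_left_mono sum_mono ES) auto
  also have "\<dots> = 4 * \<delta> + (real N * \<delta>) * (sqrt (2 * C) * (\<delta> powr - \<eta> / sqrt (real n)))"
    by simp
  also have "\<delta> powr - \<eta> / sqrt (real n) = \<delta>"
  proof -
    have "\<beta> * \<eta> + - (1 / 2) = - \<beta>" using \<eta> by (simp add: \<beta>_def field_simps)
    then have "real n powr (\<beta> * \<eta>) * real n powr - (1 / 2) = \<delta>"
      by (simp only: \<delta>_def flip: powr_add)
    moreover have "\<delta> powr - \<eta> = real n powr (\<beta> * \<eta>)" by (simp add: \<delta>_def powr_powr)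
    moreover have "real n powr - (1 / 2) = 1 / sqrt (real n)"
      unfolding powr_minus_divide by (simp add: powr_half_sqrt)
    ultimately show ?thesis by simp
  qed
  also have "4 * \<delta> + (real N * \<delta>) * (sqrt (2 * C) * \<delta>) \<le> 4 * \<delta> + (2 * A + 1) * (sqrt (2 * C) * \<delta>)"
    using N_le C \<delta> by (intro add_left_mono mult_right_mono) auto
  also have "\<dots> = (4 + (2 * A + 1) * sqrt (2 * C)) / real n powr \<beta>"
    by (simp add: \<delta>_def powr_minus divide_inverse algebra_simps)
  finally show ?thesis by (simp add: \<beta>_def)
qed

end

theorem theorem5p2:
  fixes M :: "'a measure" and X :: "nat \<Rightarrow> 'a \<Rightarrow> real" and \<mu> :: "real measure"
    and A :: real and D :: "real \<Rightarrow> real"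
  assumes "prob_space M"
    and "\<And>k. k \<ge> 1 \<Longrightarrow> X k \<in> borel_measurable M"
    and "stationary_process M X"
    and "ergodic_process M X"
    and "\<And>k. k \<ge> 1 \<Longrightarrow> distr M borel (X k) = \<mu>"
    and "A > 0"
    and "\<And>k. k \<ge> 1 \<Longrightarrow> AE \<omega> in M. \<bar>X k \<omega>\<bar> \<le> A"
    and "devroye_inequality M X D"
    and "\<And>\<eta>. \<eta> \<in> {0<..1} \<Longrightarrow>
           \<exists>C>0. \<forall>u. holder_continuous \<eta> u \<longrightarrow>
             summable (\<lambda>l. \<bar>autocov M X u (Suc l)\<bar>) \<and>
             (\<Sum>l. \<bar>autocov M X u (Suc l)\<bar>) \<le> C * (holder_const \<eta> u)\<^sup>2"
  shows "\<forall>\<eta>\<in>{0<..1}. \<exists>a>0. \<forall>t>0. \<forall>n\<ge>1.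
           measure M {\<omega> \<in> space M. kantorovich (empirical_measure X n \<omega>) \<mu>
               > ereal (t + a / real n powr (1 / (2 * (1 + \<eta>))))}
             \<le> D 1 / (real n * t\<^sup>2)"
proof (intro ballI)
  fix \<eta> :: real assume \<eta>: "\<eta> \<in> {0<..1}"
  interpret bounded_stationary_process M X \<mu> A
    by (intro bounded_stationary_process.intro bounded_stationary_process_axioms.intro
        assms(1-3,5,7))
  from assms(9)[OF \<eta>] obtain C where C: "C > 0"
    and cov: "\<forall>u. holder_continuous \<eta> u \<longrightarrow>
      summable (\<lambda>l. \<bar>autocov M X u (Suc l)\<bar>) \<and>
      (\<Sum>l. \<bar>autocov M X u (Suc l)\<bar>) \<le> C * (holder_const \<eta> u)\<^sup>2"
    by (elim exE conjE)
  \<comment> \<open>Free of t and n: 4 is the interpolation cost, 2 * A + 1 bounds the length of the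
    grid, and \<open>sqrt (2 * C)\<close> comes from the covariances.\<close>
  let ?a = "4 + (2 * A + 1) * sqrt (2 * C)"
  have "?a > 0" using assms(6) C by (simp add: add_pos_nonneg)
  moreover have "measure M {\<omega> \<in> space M. kantorovich (empirical_measure X n \<omega>) \<mu>
      > ereal (t + ?a / real n powr (1 / (2 * (1 + \<eta>))))} \<le> D 1 / (real n * t\<^sup>2)"
    if "t > 0" "n \<ge> 1" for t n
    by (rule deviation_distance_le[OF assms(8) that(2,1)
          expectation_distance_le[OF \<eta> C cov[rule_format, THEN conjunct1]
            cov[rule_format, THEN conjunct2] that(2)]])
  ultimately show "\<exists>a>0. \<forall>t>0. \<forall>n\<ge>1.
           measure M {\<omega> \<in> space M. kantorovich (empirical_measure X n \<omega>) \<mu>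
               > ereal (t + a / real n powr (1 / (2 * (1 + \<eta>))))}
             \<le> D 1 / (real n * t\<^sup>2)"
    by (intro exI[of _ ?a] conjI allI impI)
qed

end
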